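(* Let $h$ be a Legendre function on $\mathbb{R}^n$ and let $f,g:\mathbb{R}^n\to(-\infty,+\infty]$ be proper, closed and convex (possibly nonsmooth). Assume: (a) $\mathrm{im}(\nabla h^* )\subset\mathrm{dom}\,f\cap\mathrm{dom}\,g$; (b) there is $G>0$ such that $\|s\|_\infty\le G$ for every subgradient $s$ of $f$ and every subgradient $s$ of $g$ (at any point); (c) $h$ is $\sigma$-strongly convex over the probability simplex ($\sigma>0$); (d) $\nabla h^*$ is Lipschitz continuous. Then the Bregman Douglas-Rachford splitting method (BDRS) with $\gamma_k=1/\sqrt{k}$, $k\ge1$, for solving $\min_x f(x)+g(x)$ converges sublinearly; that is, for its iterates $x^{k+1}$ and $x^*$ a minimizer of $f+g$, $$\min_{1\le k\le N}\big(f(x^{k+1})+g(x^{k+1})\big)-\big(f(x^* )+g(x^* )\big)\to 0\quad\text{as }N\to\infty,$$ at the sublinear rate $O(\log N/\sqrt N)$.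
   Context: A function $h$ is Legendre if it is proper, lower semicontinuous, strictly convex and essentially smooth; then $\nabla h:\mathrm{int\,dom}\,h\to\mathrm{int\,dom}\,h^*$ is a bijection with inverse $\nabla h^*$. The Bregman distance is $D_h(x,y)=h(x)-h(y)-\langle\nabla h(y),x-y\rangle$. Strong convexity over the probability simplex $\Delta=\{x\ge0,\ \sum_i x_i=1\}$ is with respect to the $\ell_1$ norm: $D_h(x,y)\ge\frac\sigma2\|x-y\|_1^2$ for all $x\in\Delta\cap\mathrm{dom}\,h$, $y\in\Delta\cap\mathrm{int\,dom}\,h$. BDRS for $\min_x f(x)+g(x)$ takes the form (with $\partial f(w^k)$, $\partial g(z^k)$ below standing for any chosen subgradients): from $x^1\in\mathrm{int\,dom}\,h$, for $k\ge1$, $$w^k=\operatorname{argmin}_w\ f(w)+\tfrac1{\gamma_k}D_h(w,x^k),\qquad \bar x^k=\nabla h^*\big(\nabla h(w^k)-\gamma_k\,\partial f(w^k)\big),$$ $$z^k=\operatorname{argmin}_z\ g(z)+\tfrac1{\gamma_k}D_h(z,\bar x^k),\qquad y^k=\nabla h^*\big(\nabla h(z^k)-\gamma_k\,\partial g(z^k)\big),$$ $$x^{k+1}=\nabla h^*\big(\tfrac12\nabla h(x^k)+\tfrac12\nabla h(y^k)\big).$$ Standing conventions: the problem $\min_x f(x)+g(x)$ has a minimizer $x^*\in\mathrm{dom}\,h$, and the iterates are well defined and lie in $\mathrm{int\,dom}\,h$. *)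

theory Defs
  imports "HOL-Analysis.Analysis" "HOL-Library.Landau_Symbols"
begin

text \<open>Functions with values in (-\<infinity>, +\<infinity>] are modelled as \<^typ>\<open>ereal\<close>-valued
  functions; the value -\<infinity> is excluded by \<open>proper_fun\<close>.\<close>

definition edom :: "('a \<Rightarrow> ereal) \<Rightarrow> 'a set" where
  "edom f = {x. f x < \<infinity>}"

definition proper_fun :: "('a \<Rightarrow> ereal) \<Rightarrow> bool" where
  "proper_fun f \<longleftrightarrow> edom f \<noteq> {} \<and> (\<forall>x. f x \<noteq> -\<infinity>)"

definition lsc_fun :: "('a::topological_space \<Rightarrow> ereal) \<Rightarrow> bool" where
  "lsc_fun f \<longleftrightarrow> (\<forall>x. f x \<le> Liminf (at x) f)"

definition closed_fun :: "('a::topological_space \<Rightarrow> ereal) \<Rightarrow> bool" where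
  "closed_fun f \<longleftrightarrow> closed {(x, r::real). f x \<le> ereal r}"

definition convex_fun :: "('a::real_vector \<Rightarrow> ereal) \<Rightarrow> bool" where
  "convex_fun f \<longleftrightarrow> (\<forall>x\<in>edom f. \<forall>y\<in>edom f. \<forall>t. 0 < t \<and> t < 1 \<longrightarrow>
     f ((1 - t) *\<^sub>R x + t *\<^sub>R y) \<le> ereal (1 - t) * f x + ereal t * f y)"

definition strictly_convex_fun :: "('a::real_vector \<Rightarrow> ereal) \<Rightarrow> bool" where
  "strictly_convex_fun f \<longleftrightarrow> (\<forall>x\<in>edom f. \<forall>y\<in>edom f. \<forall>t. x \<noteq> y \<and> 0 < t \<and> t < 1 \<longrightarrow>
     f ((1 - t) *\<^sub>R x + t *\<^sub>R y) < ereal (1 - t) * f x + ereal t * f y)"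

text \<open>Only meaningful at points of \<open>interior (edom f)\<close>, near which \<open>f\<close> is real-valued
  when it is proper; elsewhere the value is unspecified.\<close>

definition grad :: "('a::real_inner \<Rightarrow> ereal) \<Rightarrow> 'a \<Rightarrow> 'a" where
  "grad f x = (THE v. GDERIV (\<lambda>y. real_of_ereal (f y)) x :> v)"

definition essentially_smooth :: "('a::real_inner \<Rightarrow> ereal) \<Rightarrow> bool" where
  "essentially_smooth f \<longleftrightarrow>
     interior (edom f) \<noteq> {} \<and>
     (\<forall>x\<in>interior (edom f). (\<lambda>y. real_of_ereal (f y)) differentiable (at x)) \<and>
     (\<forall>u p. (\<forall>i. u i \<in> interior (edom f)) \<and> u \<longlonglongrightarrow> p \<and> p \<in> frontier (interior (edom f)) \<longrightarrow>
        filterlim (\<lambda>i::nat. norm (grad f (u i))) at_top sequentially)"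

definition legendre :: "('a::real_inner \<Rightarrow> ereal) \<Rightarrow> bool" where
  "legendre h \<longleftrightarrow> proper_fun h \<and> lsc_fun h \<and> strictly_convex_fun h \<and> essentially_smooth h"

definition fenchel_conj :: "('a::real_inner \<Rightarrow> ereal) \<Rightarrow> 'a \<Rightarrow> ereal" where
  "fenchel_conj h u = (SUP x. ereal (u \<bullet> x) - h x)"

definition bregman :: "('a::real_inner \<Rightarrow> ereal) \<Rightarrow> 'a \<Rightarrow> 'a \<Rightarrow> ereal" where
  "bregman h x y = h x - h y - ereal (grad h y \<bullet> (x - y))"

text \<open>For proper \<open>f\<close> this set is empty at every point outside \<open>edom f\<close>.\<close>

definition subdiff :: "('a::real_inner \<Rightarrow> ereal) \<Rightarrow> 'a \<Rightarrow> 'a set" where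
  "subdiff f x = {s. \<forall>y. f y \<ge> f x + ereal (s \<bullet> (y - x))}"

definition l1_norm :: "real ^ 'n \<Rightarrow> real" where
  "l1_norm x = (\<Sum>i\<in>UNIV. \<bar>x $ i\<bar>)"

definition prob_simplex :: "(real ^ 'n) set" where
  "prob_simplex = {x. (\<forall>i. 0 \<le> x $ i) \<and> (\<Sum>i\<in>UNIV. x $ i) = 1}"

definition strongly_convex_on_simplex :: "real \<Rightarrow> (real ^ 'n \<Rightarrow> ereal) \<Rightarrow> bool" where
  "strongly_convex_on_simplex \<sigma> h \<longleftrightarrow>
     (\<forall>x \<in> prob_simplex \<inter> edom h. \<forall>y \<in> prob_simplex \<inter> interior (edom h).
        bregman h x y \<ge> ereal (\<sigma> / 2 * (l1_norm (x - y))\<^sup>2))"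

text \<open>The point \<open>p\<close> is a minimizer of \<open>f + (1/\<gamma>) D_h(_, x)\<close> over the whole space.\<close>

definition bregman_prox ::
  "('a::real_inner \<Rightarrow> ereal) \<Rightarrow> ('a \<Rightarrow> ereal) \<Rightarrow> real \<Rightarrow> 'a \<Rightarrow> 'a \<Rightarrow> bool" where
  "bregman_prox h f \<gamma> x p \<longleftrightarrow>
     is_arg_min (\<lambda>v. f v + ereal (1 / \<gamma>) * bregman h v x) (\<lambda>_. True) p"

text \<open>\<open>p = \<nabla>h\<^sup>*(u)\<close>, together with the requirement that this expression is well defined.\<close>

definition is_mirror_image :: "('a::real_inner \<Rightarrow> ereal) \<Rightarrow> 'a \<Rightarrow> 'a \<Rightarrow> bool" where
  "is_mirror_image h u p \<longleftrightarrow>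
     u \<in> interior (edom (fenchel_conj h)) \<and> p = grad (fenchel_conj h) u"

text \<open>Sequences are indexed from 1; the entries at index 0 are irrelevant. The sequences \<open>s\<close> and
  \<open>t\<close> are the chosen subgradients of \<open>f\<close> at \<open>w k\<close> and of \<open>g\<close> at \<open>z k\<close>; they need not be the
  subgradients occurring in the optimality conditions of the two minimizations.\<close>

definition bdrs ::
  "('a::real_inner \<Rightarrow> ereal) \<Rightarrow> ('a \<Rightarrow> ereal) \<Rightarrow> ('a \<Rightarrow> ereal) \<Rightarrow> (nat \<Rightarrow> real) \<Rightarrow>
   (nat \<Rightarrow> 'a) \<Rightarrow> (nat \<Rightarrow> 'a) \<Rightarrow> (nat \<Rightarrow> 'a) \<Rightarrow> (nat \<Rightarrow> 'a) \<Rightarrow> (nat \<Rightarrow> 'a) \<Rightarrow>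
   (nat \<Rightarrow> 'a) \<Rightarrow> (nat \<Rightarrow> 'a) \<Rightarrow> bool" where
  "bdrs h f g \<gamma> x w xbar z y s t \<longleftrightarrow>
     x 1 \<in> interior (edom h) \<and>
     (\<forall>k\<ge>1.
        bregman_prox h f (\<gamma> k) (x k) (w k) \<and>
        s k \<in> subdiff f (w k) \<and>
        is_mirror_image h (grad h (w k) - \<gamma> k *\<^sub>R s k) (xbar k) \<and>
        bregman_prox h g (\<gamma> k) (xbar k) (z k) \<and>
        t k \<in> subdiff g (z k) \<and>
        is_mirror_image h (grad h (z k) - \<gamma> k *\<^sub>R t k) (y k) \<and>
        is_mirror_image h ((1/2) *\<^sub>R grad h (x k) + (1/2) *\<^sub>R grad h (y k)) (x (Suc k)))"

definition best_gap :: "('a \<Rightarrow> ereal) \<Rightarrow> ('a \<Rightarrow> ereal) \<Rightarrow> (nat \<Rightarrow> 'a) \<Rightarrow> 'a \<Rightarrow> nat \<Rightarrow> ereal" where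
  "best_gap f g x xs N = (MIN k\<in>{1..N}. f (x (k + 1)) + g (x (k + 1))) - (f xs + g xs)"

end

theory Submission
  imports Defs "HOL-Real_Asymp.Real_Asymp"
begin

text \<open>The method is mirror descent in disguise. Since \<open>\<nabla>h\<close> and \<open>\<nabla>h\<^sup>*\<close> are mutually inverse, the
  optimality conditions of the two proximal steps, with subgradients \<open>s'\<close> and \<open>t'\<close>, turn one
  iteration into \<open>\<nabla>h(x\<^sup>+) = \<nabla>h(x) - \<gamma>/2 (s + s' + t + t')\<close>. All points of the iteration have dual
  images within \<open>O(\<gamma>)\<close> of each other, so by Lipschitz continuity of \<open>\<nabla>h\<^sup>*\<close> they are
  themselves \<open>O(\<gamma>)\<close>-close, and bounded subgradients allow to replace \<open>f(w)\<close> and \<open>g(z)\<close> by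
  \<open>f(x\<^sup>+)\<close> and \<open>g(x\<^sup>+)\<close> at the cost of \<open>O(\<gamma>)\<close>. With \<open>F = f + g\<close> this gives
  \<open>D(x\<^sup>*, x\<^sup>+) \<le> D(x\<^sup>*, x) - \<gamma> (F(x\<^sup>+) - F(x\<^sup>*)) + O(\<gamma>\<^sup>2)\<close>; now sum over \<open>k\<close> with
  \<open>\<gamma> = 1/\<surd>k\<close>.\<close>

subsection \<open>Extended-real convex functions and subgradients\<close>

lemma ereal_real_edom:
  assumes "proper_fun f" "x \<in> edom f"
  shows "f x = ereal (real_of_ereal (f x))"
  using assms by (cases "f x") (auto simp: proper_fun_def edom_def)

lemma convex_fun_real:
  assumes "proper_fun f" "convex_fun f" "x \<in> edom f" "y \<in> edom f" "0 \<le> t" "t \<le> 1"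
  shows "f ((1 - t) *\<^sub>R x + t *\<^sub>R y)
    \<le> ereal ((1 - t) * real_of_ereal (f x) + t * real_of_ereal (f y))"
proof -
  note fx = ereal_real_edom[OF assms(1,3)] and fy = ereal_real_edom[OF assms(1,4)]
  consider "t = 0" | "t = 1" | "0 < t" "t < 1" using assms by linarith
  then show ?thesis
  proof cases
    case 3
    then have "f ((1 - t) *\<^sub>R x + t *\<^sub>R y) \<le> ereal (1 - t) * f x + ereal t * f y"
      using assms(2-4) unfolding convex_fun_def by blast
    also have "\<dots> = ereal ((1 - t) * real_of_ereal (f x) + t * real_of_ereal (f y))"
      by (subst fx, subst fy) simp
    finally show ?thesis .
  qed (use fx fy in auto)
qed

lemma strictly_convex_imp_convex_fun:
  assumes "proper_fun h" "strictly_convex_fun h"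
  shows "convex_fun h"
  unfolding convex_fun_def
proof (intro ballI allI impI)
  fix x y and t :: real
  assume *: "x \<in> edom h" "y \<in> edom h" "0 < t \<and> t < 1"
  show "h ((1 - t) *\<^sub>R x + t *\<^sub>R y) \<le> ereal (1 - t) * h x + ereal t * h y"
  proof (cases "x = y")
    case True
    obtain a where "h x = ereal a" using ereal_real_edom[OF assms(1) *(1)] by blast
    then show ?thesis using True by (simp add: scaleR_left_distrib[symmetric] algebra_simps)
  next
    case False
    then show ?thesis using assms(2) * unfolding strictly_convex_fun_def by (meson less_imp_le)
  qed
qed

lemma subdiff_edom:
  assumes "proper_fun f" "s \<in> subdiff f x"
  shows "x \<in> edom f"
proof (rule ccontr)
  assume "x \<notin> edom f"
  then have "f x = \<infinity>" by (simp add: edom_def)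
  then have "f y = \<infinity>" for y using assms(2) by (auto simp: subdiff_def split: if_splits)
  then show False using assms(1) by (auto simp: proper_fun_def edom_def)
qed

lemma subdiff_real:
  assumes "proper_fun f" "s \<in> subdiff f x" "y \<in> edom f"
  shows "real_of_ereal (f x) + s \<bullet> (y - x) \<le> real_of_ereal (f y)"
proof -
  obtain a b where "f x = ereal a" "f y = ereal b"
    using ereal_real_edom[OF assms(1)] subdiff_edom[OF assms(1,2)] assms(3) by blast
  then show ?thesis using assms(2) by (auto simp: subdiff_def dest!: spec[of _ y])
qed

lemma subdiffI_real:
  assumes "proper_fun f" "x \<in> edom f"
    and "\<And>y. y \<in> edom f \<Longrightarrow> real_of_ereal (f x) + s \<bullet> (y - x) \<le> real_of_ereal (f y)"
  shows "s \<in> subdiff f x"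
  unfolding subdiff_def
proof (intro CollectI allI)
  fix y
  show "f x + ereal (s \<bullet> (y - x)) \<le> f y"
  proof (cases "y \<in> edom f")
    case True
    obtain a b where "f x = ereal a" "f y = ereal b"
      using ereal_real_edom[OF assms(1)] True assms(2) by blast
    then show ?thesis using assms(3)[OF True] by simp
  next
    case False
    then show ?thesis by (simp add: edom_def)
  qed
qed

section \<open>Lower semicontinuity and attainment of minima on compact sets\<close>

lemma lsc_fun_eventually:
  assumes "lsc_fun f" "c < f x"
  shows "eventually (\<lambda>y. c < f y) (nhds x)"
proof -
  have "\<forall>y<f x. eventually (\<lambda>v. y < f v) (at x)"
    using assms(1) unfolding lsc_fun_def le_Liminf_iff by blast
  then show ?thesis using assms(2) by (simp add: eventually_nhds_conv_at)
qed

text \<open>If every point of \<open>K\<close> were beaten by another, the open sets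
  \<open>U y\<close>, on which \<open>f\<close> exceeds \<open>f y\<close>, would cover
  \<open>K\<close>. The member of a finite subcover with the least \<open>f y\<close> would then
  itself lie in some \<open>U z\<close> and exceed \<open>f z\<close>.\<close>

lemma lsc_fun_attains_min:
  assumes "lsc_fun f" "compact K" "K \<noteq> {}"
  shows "\<exists>x\<in>K. \<forall>y\<in>K. f x \<le> f y"
proof (rule ccontr)
  assume "\<not> ?thesis"
  then have lower: "\<exists>y\<in>K. f y < f x" if "x \<in> K" for x using that by (auto simp: not_le)
  define U where "U y = interior {x. f y < f x}" for y
  have "K \<subseteq> (\<Union>y\<in>K. U y)"
  proof
    fix x assume "x \<in> K"
    then obtain y where "y \<in> K" "f y < f x" using lower by blast
    then have "x \<in> U y"
      using lsc_fun_eventually[OF assms(1)] unfolding U_def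
      by (metis (mono_tags, lifting) eventually_nhds interiorI mem_Collect_eq subsetI)
    then show "x \<in> (\<Union>y\<in>K. U y)" using \<open>y \<in> K\<close> by blast
  qed
  then obtain T where T: "T \<subseteq> K" "finite T" "K \<subseteq> (\<Union>y\<in>T. U y)"
    using compactE_image[OF assms(2), of K U] by (auto simp: U_def)
  have "T \<noteq> {}" using T assms(3) by auto
  then obtain y where y: "y \<in> T" "\<And>z. z \<in> T \<Longrightarrow> f y \<le> f z"
    using T(2) by (metis (no_types, lifting) arg_min_if_finite(1) arg_min_least)
  then obtain z where "z \<in> T" "y \<in> U z" using T by blast
  then have "f z < f y" using interior_subset unfolding U_def by blast
  then show False using y(2)[OF \<open>z \<in> T\<close>] by simp
qed

lemma lsc_fun_diff_inner:
  fixes f :: "'a::real_inner \<Rightarrow> ereal"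
  assumes "lsc_fun f"
  shows "lsc_fun (\<lambda>x. f x - ereal (u \<bullet> x))"
  unfolding lsc_fun_def le_Liminf_iff
proof (intro allI impI)
  fix x and c :: ereal
  assume c: "c < f x - ereal (u \<bullet> x)"
  \<comment> \<open>Inserting \<open>d\<close> strictly between the two values forces it to be real
    even when \<open>c\<close> is -\<infinity>. The further gap from \<open>d\<close> to
    \<open>e\<close> absorbs the variation of the linear term near \<open>x\<close>.\<close>
  obtain d where d: "c < d" "d < f x - ereal (u \<bullet> x)" using dense[OF c] by blast
  show "eventually (\<lambda>y. c < f y - ereal (u \<bullet> y)) (at x)"
  proof (cases d)
    case (real r)
    obtain e where e: "d < e" "e < f x - ereal (u \<bullet> x)" using dense[OF d(2)] by blast
    then obtain q where q: "e = ereal q" using real by (cases e) auto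
    have "ereal (q + u \<bullet> x) < f x" using e(2) q by (cases "f x") auto
    then have "eventually (\<lambda>y. ereal (q + u \<bullet> x) < f y) (at x)"
      using lsc_fun_eventually[OF assms] by (simp add: eventually_nhds_conv_at)
    moreover have "((\<lambda>y. u \<bullet> y) \<longlongrightarrow> u \<bullet> x) (at x)" by (intro tendsto_intros)
    then have "eventually (\<lambda>y. u \<bullet> y < u \<bullet> x + (q - r)) (at x)"
      by (rule order_tendstoD) (use e q real in auto)
    ultimately show ?thesis
    proof eventually_elim
      case (elim y)
      have "d < f y - ereal (u \<bullet> y)" using elim real by (cases "f y") auto
      then show ?case using d(1) by simp
    qed
  qed (use d in auto)
qed

section \<open>Existence of subgradients at interior points of the domain\<close>

lemma edom_convex_comb:
  assumes "proper_fun f" "convex_fun f" "x \<in> edom f" "y \<in> edom f" "0 \<le> t" "t \<le> 1"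
  shows "(1 - t) *\<^sub>R x + t *\<^sub>R y \<in> edom f"
  using convex_fun_real[OF assms] by (auto simp: edom_def)

lemma convex_fun_real':
  assumes "proper_fun f" "convex_fun f" "x \<in> edom f" "y \<in> edom f" "0 \<le> t" "t \<le> 1"
  shows "real_of_ereal (f ((1 - t) *\<^sub>R x + t *\<^sub>R y))
    \<le> (1 - t) * real_of_ereal (f x) + t * real_of_ereal (f y)"
  using convex_fun_real[OF assms] ereal_real_edom[OF assms(1) edom_convex_comb[OF assms]]
  by (metis ereal_less_eq(3))

text \<open>A hyperplane with normal \<open>(v, \<alpha>)\<close> separates \<open>(x, f x)\<close>
  from the strict epigraph. Raising the height shows \<alpha> \<ge> 0, interiority of
  \<open>x\<close> excludes a vertical hyperplane, and dividing by \<alpha> gives the subgradient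
  \<open>- v / \<alpha>\<close>.\<close>

lemma subdiff_nonempty_interior:
  fixes f :: "'a::euclidean_space \<Rightarrow> ereal"
  assumes f: "proper_fun f" "convex_fun f" and x: "x \<in> interior (edom f)"
  shows "subdiff f x \<noteq> {}"
proof -
  let ?F = "\<lambda>y. real_of_ereal (f y)"
  define S where "S = {(y, r). y \<in> edom f \<and> ?F y < r}"
  have xd: "x \<in> edom f" using x interior_subset by blast
  have "convex S"
    unfolding convex_alt
  proof (intro ballI allI impI)
    fix p q and t :: real assume pq: "p \<in> S" "q \<in> S" and t: "0 \<le> t \<and> t \<le> 1"
    obtain y r where p: "p = (y, r)" "y \<in> edom f" "?F y < r" using pq by (auto simp: S_def)
    obtain y' r' where q: "q = (y', r')" "y' \<in> edom f" "?F y' < r'" using pq by (auto simp: S_def)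
    have "(1 - t) * ?F y + t * ?F y' < (1 - t) * r + t * r'"
    proof (cases "t = 0")
      case False
      then have "t * ?F y' < t * r'" using t q by simp
      moreover have "(1 - t) * ?F y \<le> (1 - t) * r" using t p by (intro mult_left_mono) auto
      ultimately show ?thesis by linarith
    qed (use p in simp)
    then show "(1 - t) *\<^sub>R p + t *\<^sub>R q \<in> S"
      using convex_fun_real'[OF f p(2) q(2)] edom_convex_comb[OF f p(2) q(2)] t
      by (fastforce simp: S_def p q)
  qed
  moreover have "(x, ?F x + 1) \<in> S" using xd by (simp add: S_def)
  then have "S \<noteq> {}" by blast
  moreover have "{(x, ?F x)} \<inter> S = {}" by (auto simp: S_def)
  ultimately have "\<exists>a b. a \<noteq> 0 \<and> (\<forall>p\<in>{(x, ?F x)}. a \<bullet> p \<le> b) \<and> (\<forall>p\<in>S. b \<le> a \<bullet> p)"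
    by (intro separating_hyperplane_sets) auto
  then obtain a b where ab: "a \<noteq> 0" "a \<bullet> (x, ?F x) \<le> b" "\<And>p. p \<in> S \<Longrightarrow> b \<le> a \<bullet> p"
    by blast
  obtain v \<alpha> where a: "a = (v, \<alpha>)" by (cases a)
  have sep: "v \<bullet> x + \<alpha> * ?F x \<le> v \<bullet> y + \<alpha> * r" if "y \<in> edom f" "?F y < r" for y r
    using ab(2) ab(3)[of "(y, r)"] that by (auto simp: a S_def)
  have "\<alpha> \<ge> 0" using sep[OF xd, of "?F x + 1"] by (simp add: algebra_simps)
  moreover have "\<alpha> \<noteq> 0"
  proof
    assume 0: "\<alpha> = 0"
    then have "v \<noteq> 0" using ab(1) a by (auto simp: zero_prod_def)
    obtain e where e: "e > 0" "ball x e \<subseteq> edom f" using x by (auto simp: mem_interior)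
    \<comment> \<open>With \<alpha> = 0 the separation says that \<open>x\<close> minimizes the
      inner product with \<open>v\<close> over the domain. A step of length \<open>e / 2\<close>
      against \<open>v\<close> stays in the ball and lowers it.\<close>
    define y where "y = x - (e / (2 * norm v)) *\<^sub>R v"
    have "y \<in> ball x e" using e \<open>v \<noteq> 0\<close> by (simp add: y_def dist_norm)
    then have "v \<bullet> x \<le> v \<bullet> y" using sep[of y "?F y + 1"] e 0 by auto
    moreover have "v \<bullet> y = v \<bullet> x - (e / (2 * norm v)) * (v \<bullet> v)" by (simp add: y_def inner_diff_right)
    moreover have "(e / (2 * norm v)) * (v \<bullet> v) > 0" using e \<open>v \<noteq> 0\<close> by simp
    ultimately show False by linarith
  qed
  ultimately have pos: "\<alpha> > 0" by simp
  have "(- 1 / \<alpha>) *\<^sub>R v \<in> subdiff f x"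
  proof (rule subdiffI_real[OF f(1) xd])
    fix y assume y: "y \<in> edom f"
    show "?F x + ((- 1 / \<alpha>) *\<^sub>R v) \<bullet> (y - x) \<le> ?F y"
    proof (rule field_le_epsilon)
      fix e :: real assume "e > 0"
      then have "v \<bullet> x + \<alpha> * ?F x \<le> v \<bullet> y + \<alpha> * (?F y + e)" using sep[OF y] by simp
      then have "(v \<bullet> x + \<alpha> * ?F x) / \<alpha> \<le> (v \<bullet> y + \<alpha> * (?F y + e)) / \<alpha>"
        using pos by (simp add: divide_right_mono)
      then show "?F x + ((- 1 / \<alpha>) *\<^sub>R v) \<bullet> (y - x) \<le> ?F y + e"
        using pos by (simp add: inner_diff_right add_divide_distrib diff_divide_distrib)
    qed
  qed
  then show ?thesis by blast
qed

section \<open>Gradients and their agreement with subgradients at interior points\<close>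

lemma GDERIV_unique_real:
  fixes F :: "'a::real_inner \<Rightarrow> real"
  assumes "GDERIV F x :> u" "GDERIV F x :> v"
  shows "u = v"
proof -
  have "(\<lambda>h. h \<bullet> u) = (\<lambda>h. h \<bullet> v)"
    using has_derivative_unique assms unfolding gderiv_def by blast
  then have "(u - v) \<bullet> u = (u - v) \<bullet> v" by (rule fun_cong)
  then show ?thesis by (metis inner_diff_right inner_eq_zero_iff right_minus_eq)
qed

lemma grad_eqI: "GDERIV (\<lambda>y. real_of_ereal (f y)) x :> v \<Longrightarrow> grad f x = v"
  unfolding grad_def using GDERIV_unique_real by blast

lemma GDERIV_grad:
  fixes f :: "'a::euclidean_space \<Rightarrow> ereal"
  assumes "(\<lambda>y. real_of_ereal (f y)) differentiable (at x)"
  shows "GDERIV (\<lambda>y. real_of_ereal (f y)) x :> grad f x"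
proof -
  obtain f' where f': "((\<lambda>y. real_of_ereal (f y)) has_derivative f') (at x)"
    using assms unfolding differentiable_def by blast
  define v where "v = (\<Sum>b\<in>Basis. f' b *\<^sub>R b)"
  have lin: "linear f'" using f' has_derivative_linear by blast
  have "f' = (\<lambda>h. h \<bullet> v)"
  proof
    fix h
    have "f' h = f' (\<Sum>b\<in>Basis. (h \<bullet> b) *\<^sub>R b)" by (simp add: euclidean_representation)
    also have "\<dots> = (\<Sum>b\<in>Basis. (h \<bullet> b) * f' b)"
      by (simp add: linear_sum[OF lin] linear_cmul[OF lin])
    also have "\<dots> = h \<bullet> v" by (simp add: v_def inner_sum_right mult.commute)
    finally show "f' h = h \<bullet> v" .
  qed
  then have "GDERIV (\<lambda>y. real_of_ereal (f y)) x :> v" using f' by (simp add: gderiv_def)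
  then show ?thesis using grad_eqI by metis
qed

text \<open>Subtracting the linear function with slope \<open>s\<close> leaves a function with a
  local minimum at \<open>x\<close>, so its derivative there vanishes.\<close>

lemma subdiff_eq_grad:
  fixes f :: "'a::euclidean_space \<Rightarrow> ereal"
  assumes f: "proper_fun f" and x: "x \<in> interior (edom f)"
    and diff: "(\<lambda>y. real_of_ereal (f y)) differentiable (at x)" and s: "s \<in> subdiff f x"
  shows "s = grad f x"
proof -
  let ?F = "\<lambda>y. real_of_ereal (f y)"
  have *: "((\<lambda>y. ?F y - y \<bullet> s) has_derivative (\<lambda>d. d \<bullet> grad f x - d \<bullet> s)) (at x)"
    using GDERIV_grad[OF diff] unfolding gderiv_def by (intro derivative_intros) auto
  have "eventually (\<lambda>y. y \<in> edom f) (at x)"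
    using x unfolding eventually_at_topological by (metis interiorE subsetD)
  then have "eventually (\<lambda>y. ?F x - x \<bullet> s \<le> ?F y - y \<bullet> s) (at x)"
  proof eventually_elim
    case (elim y)
    show ?case using subdiff_real[OF f s elim] by (simp add: inner_diff_right inner_commute)
  qed
  then have "(\<lambda>d. d \<bullet> grad f x - d \<bullet> s) = (\<lambda>d. 0)" by (rule has_derivative_local_min[OF *])
  \<comment> \<open>Evaluated in the direction \<open>s - grad f x\<close>, the zero derivative is
    minus the squared norm of that direction.\<close>
  then have "(s - grad f x) \<bullet> grad f x - (s - grad f x) \<bullet> s = 0" by (rule fun_cong)
  then show ?thesis by (metis inner_diff_right inner_eq_zero_iff right_minus_eq minus_diff_eq)
qed

lemma grad_in_subdiff:
  fixes f :: "'a::euclidean_space \<Rightarrow> ereal"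
  assumes "proper_fun f" "convex_fun f" "x \<in> interior (edom f)"
    and "(\<lambda>y. real_of_ereal (f y)) differentiable (at x)"
  shows "grad f x \<in> subdiff f x"
  using subdiff_nonempty_interior[OF assms(1-3)] subdiff_eq_grad[OF assms(1,3,4)] by blast

subsection \<open>The gradient of the conjugate\<close>

lemma fenchel_conj_ge:
  assumes "proper_fun h" "q \<in> edom h"
  shows "ereal (u \<bullet> q - real_of_ereal (h q)) \<le> fenchel_conj h u"
proof -
  have "ereal (u \<bullet> q) - h q \<le> fenchel_conj h u"
    unfolding fenchel_conj_def by (rule SUP_upper) simp
  then show ?thesis using ereal_real_edom[OF assms] by (metis ereal_minus(1))
qed

lemma fenchel_conj_le:
  assumes "proper_fun h" "\<And>v. v \<in> edom h \<Longrightarrow> u \<bullet> v - real_of_ereal (h v) \<le> c"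
  shows "fenchel_conj h u \<le> ereal c"
  unfolding fenchel_conj_def
proof (rule SUP_least)
  fix v
  show "ereal (u \<bullet> v) - h v \<le> ereal c"
  proof (cases "v \<in> edom h")
    case True
    then show ?thesis using assms(2)[OF True] ereal_real_edom[OF assms(1) True]
      by (metis ereal_less_eq(3) ereal_minus(1))
  qed (simp add: edom_def)
qed

text \<open>The equality case of the Fenchel-Young inequality: the subgradient inequality says
  exactly that \<open>q\<close> attains the supremum defining the conjugate.\<close>

lemma fenchel_conj_subdiff:
  assumes "proper_fun h" "u \<in> subdiff h q"
  shows "fenchel_conj h u = ereal (u \<bullet> q - real_of_ereal (h q))"
proof (rule antisym)
  show "fenchel_conj h u \<le> ereal (u \<bullet> q - real_of_ereal (h q))"
    using subdiff_real[OF assms] by (intro fenchel_conj_le assms(1)) (fastforce simp: inner_diff_right)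
qed (rule fenchel_conj_ge[OF assms(1) subdiff_edom[OF assms]])

text \<open>At the midpoint of \<open>q\<close> and \<open>v\<close> the tangent still bounds
  \<open>h\<close> from below, while strict convexity puts \<open>h\<close> strictly below its
  chord. Hence the tangent cannot touch the graph at \<open>v\<close>.\<close>

lemma subdiff_strict:
  assumes h: "proper_fun h" "strictly_convex_fun h" and u: "u \<in> subdiff h q"
    and v: "v \<in> edom h" "v \<noteq> q"
  shows "real_of_ereal (h q) + u \<bullet> (v - q) < real_of_ereal (h v)"
proof -
  note q = subdiff_edom[OF h(1) u]
  define c where "c = (1 - 1/2) *\<^sub>R q + (1/2::real) *\<^sub>R v"
  have "c \<in> edom h"
    unfolding c_def using h q v by (intro edom_convex_comb strictly_convex_imp_convex_fun) auto
  then obtain a b d where abd: "h q = ereal a" "h v = ereal b" "h c = ereal d"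
    using ereal_real_edom[OF h(1)] q v by meson
  have "h c < ereal (1 - 1/2) * h q + ereal (1/2) * h v"
    unfolding c_def using h(2)[unfolded strictly_convex_fun_def, rule_format, of q v "1/2"] q v by simp
  then have "d < a / 2 + b / 2" using abd by simp
  moreover have "a + u \<bullet> (c - q) \<le> d" using subdiff_real[OF h(1) u \<open>c \<in> edom h\<close>] abd by simp
  moreover have "u \<bullet> (c - q) = (u \<bullet> (v - q)) / 2"
    by (simp add: c_def inner_add_right inner_diff_right)
  ultimately show ?thesis using abd by simp
qed

text \<open>Strict convexity separates \<open>h\<close> from its tangent on the compact sphere around \<open>q\<close>;
  convexity propagates the gap linearly outwards.\<close>

lemma subdiff_linear_growth:
  fixes h :: "'a::euclidean_space \<Rightarrow> ereal"
  assumes h: "proper_fun h" "lsc_fun h" "strictly_convex_fun h" and u: "u \<in> subdiff h q"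
    and r: "r > 0"
  shows "\<exists>\<epsilon>>0. \<forall>v\<in>edom h. r \<le> norm (v - q) \<longrightarrow>
    real_of_ereal (h q) + u \<bullet> (v - q) + \<epsilon> * norm (v - q) \<le> real_of_ereal (h v)"
proof -
  let ?H = "\<lambda>v. real_of_ereal (h v)"
  note q = subdiff_edom[OF h(1) u]
  note cv = strictly_convex_imp_convex_fun[OF h(1,3)]
  have "sphere q r \<noteq> {}" using r by simp
  then obtain m where m: "m \<in> sphere q r"
    "\<And>v. v \<in> sphere q r \<Longrightarrow> h m - ereal (u \<bullet> m) \<le> h v - ereal (u \<bullet> v)"
    using lsc_fun_attains_min[OF lsc_fun_diff_inner[OF h(2)]] compact_sphere by metis
  \<comment> \<open>If the minimizer \<open>m\<close> is outside the domain, \<open>h\<close> is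
    infinite on the whole sphere and any positive gap works; 1 is an arbitrary choice.\<close>
  define e where "e = (if m \<in> edom h then ?H m - ?H q - u \<bullet> (m - q) else 1)"
  have "m \<noteq> q" using m r by auto
  then have "e > 0" using subdiff_strict[OF h(1,3) u, of m] by (cases "m \<in> edom h") (simp_all add: e_def)
  have sph: "?H q + u \<bullet> (v - q) + e \<le> ?H v" if v: "v \<in> sphere q r" "v \<in> edom h" for v
  proof -
    obtain b where b: "h v = ereal b" using ereal_real_edom[OF h(1) v(2)] by blast
    have le: "h m - ereal (u \<bullet> m) \<le> ereal (b - u \<bullet> v)" using m(2)[OF v(1)] b by simp
    then have "h m < \<infinity>" by (cases "h m") auto
    then have "m \<in> edom h" by (simp add: edom_def)
    moreover obtain a where a: "h m = ereal a"
      using ereal_real_edom[OF h(1) \<open>m \<in> edom h\<close>] by blast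
    ultimately show ?thesis using le b by (simp add: e_def inner_diff_right)
  qed
  have "?H q + u \<bullet> (v - q) + (e / r) * norm (v - q) \<le> ?H v"
    if v: "v \<in> edom h" "r \<le> norm (v - q)" for v
  proof -
    \<comment> \<open>The factor \<open>t\<close> pulls \<open>v\<close> back along the segment from
      \<open>q\<close> onto the sphere. The gap \<open>e\<close> there becomes \<open>e / t\<close>
      at \<open>v\<close>, which is proportional to the distance from \<open>q\<close>.\<close>
    define t where "t = r / norm (v - q)"
    have pos: "norm (v - q) > 0" using v r by linarith
    have t: "0 < t" "t \<le> 1" using pos r v by (auto simp: t_def)
    define c where "c = (1 - t) *\<^sub>R q + t *\<^sub>R v"
    have cq: "c - q = t *\<^sub>R (v - q)" by (simp add: c_def algebra_simps)
    have "dist q c = norm (c - q)" by (simp add: dist_norm norm_minus_commute)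
    then have "c \<in> sphere q r" using pos r by (simp add: cq t_def)
    moreover have "c \<in> edom h" unfolding c_def using h cv q v t by (intro edom_convex_comb) auto
    ultimately have "?H q + u \<bullet> (c - q) + e \<le> ?H c" by (rule sph)
    also have "\<dots> \<le> (1 - t) * ?H q + t * ?H v"
      unfolding c_def using h cv q v t by (intro convex_fun_real') auto
    finally have "e \<le> t * (?H v - ?H q - u \<bullet> (v - q))" by (simp add: cq algebra_simps)
    then have "e / t \<le> ?H v - ?H q - u \<bullet> (v - q)" using t by (simp add: divide_le_eq mult.commute)
    then show ?thesis by (simp add: t_def)
  qed
  then show ?thesis using \<open>e > 0\<close> r by (intro exI[of _ "e / r"]) auto
qed

text \<open>The competitor \<open>q\<close> in the supremum gives the lower bound
  \<open>u' \<bullet> q - h q\<close> everywhere. Linear growth of \<open>h\<close> around its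
  tangent gives the same expression plus \<open>r * norm (u' - u)\<close> as an upper bound near
  \<open>u\<close>, for every \<open>r > 0\<close>. The two bounds squeeze the conjugate, so its
  gradient is \<open>q\<close>.\<close>

lemma fenchel_conj_GDERIV:
  fixes h :: "'a::euclidean_space \<Rightarrow> ereal"
  assumes h: "proper_fun h" "lsc_fun h" "strictly_convex_fun h" and u: "u \<in> subdiff h q"
  shows "u \<in> interior (edom (fenchel_conj h))"
    and "GDERIV (\<lambda>v. real_of_ereal (fenchel_conj h v)) u :> q"
proof -
  let ?H = "\<lambda>v. real_of_ereal (h v)" and ?C = "fenchel_conj h"
  note q = subdiff_edom[OF h(1) u]
  have bnd: "\<exists>\<epsilon>>0. \<forall>u'. norm (u' - u) \<le> \<epsilon> \<longrightarrow> ?C u' \<le> ereal (u' \<bullet> q - ?H q + r * norm (u' - u))"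
    if r: "r > 0" for r
  proof -
    obtain \<epsilon> where e: "\<epsilon> > 0" "\<And>v. v \<in> edom h \<Longrightarrow> r \<le> norm (v - q) \<Longrightarrow>
        ?H q + u \<bullet> (v - q) + \<epsilon> * norm (v - q) \<le> ?H v"
      using subdiff_linear_growth[OF h u r] by blast
    have "?C u' \<le> ereal (u' \<bullet> q - ?H q + r * norm (u' - u))" if u': "norm (u' - u) \<le> \<epsilon>" for u'
    proof (rule fenchel_conj_le[OF h(1)])
      fix v assume v: "v \<in> edom h"
      \<comment> \<open>The term to control is the inner product of \<open>u' - u\<close> and
        \<open>v - q\<close>. At distance at least \<open>r\<close> from \<open>q\<close> the growth
        of \<open>h\<close> absorbs it; closer to \<open>q\<close> it is at most
        \<open>r * norm (u' - u)\<close>.\<close>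
      have cs: "(u' - u) \<bullet> (v - q) \<le> norm (u' - u) * norm (v - q)" by (rule norm_cauchy_schwarz)
      have eq: "u' \<bullet> v - ?H v = u' \<bullet> q + (u' - u) \<bullet> (v - q) + u \<bullet> (v - q) - ?H v"
        by (simp add: algebra_simps)
      show "u' \<bullet> v - ?H v \<le> u' \<bullet> q - ?H q + r * norm (u' - u)"
      proof (cases "r \<le> norm (v - q)")
        case True
        have "norm (u' - u) * norm (v - q) \<le> \<epsilon> * norm (v - q)" using u' by (intro mult_right_mono) auto
        moreover have "0 \<le> r * norm (u' - u)" using r by simp
        ultimately show ?thesis using e(2)[OF v True] cs eq by linarith
      next
        case False
        then have "norm (u' - u) * norm (v - q) \<le> r * norm (u' - u)"
          by (subst mult.commute, intro mult_right_mono) auto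
        then show ?thesis using subdiff_real[OF h(1) u v] cs eq by linarith
      qed
    qed
    then show ?thesis using e(1) by blast
  qed
  \<comment> \<open>For finiteness near \<open>u\<close> one fixed radius suffices;
    differentiability below takes the radius equal to the tolerance \<open>e\<close>.\<close>
  obtain \<epsilon> where "\<epsilon> > 0" "\<And>u'. norm (u' - u) \<le> \<epsilon> \<Longrightarrow> ?C u' \<le> ereal (u' \<bullet> q - ?H q + 1 * norm (u' - u))"
    using bnd[of 1] by auto
  then have "?C u' \<noteq> \<infinity>" if "dist u u' < \<epsilon>" for u'
    using that by (metis PInfty_neq_ereal(1) dist_norm ereal_infty_less_eq(1) less_imp_le norm_minus_commute)
  then have "ball u \<epsilon> \<subseteq> edom ?C" by (auto simp: edom_def)
  then show "u \<in> interior (edom ?C)" using \<open>\<epsilon> > 0\<close> by (auto simp: mem_interior)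
  show "GDERIV (\<lambda>v. real_of_ereal (?C v)) u :> q"
    unfolding gderiv_def has_derivative_at_alt
  proof (intro conjI allI impI)
    show "bounded_linear (\<lambda>d. d \<bullet> q)" by (rule bounded_linear_inner_left)
    fix e :: real assume "e > 0"
    then obtain \<epsilon> where e: "\<epsilon> > 0" "\<And>u'. norm (u' - u) \<le> \<epsilon> \<Longrightarrow> ?C u' \<le> ereal (u' \<bullet> q - ?H q + e * norm (u' - u))"
      using bnd by blast
    have "norm (real_of_ereal (?C u') - real_of_ereal (?C u) - (u' - u) \<bullet> q) \<le> e * norm (u' - u)"
      if "norm (u' - u) < \<epsilon>" for u'
    proof -
      have up: "?C u' \<le> ereal (u' \<bullet> q - ?H q + e * norm (u' - u))" using e(2) that by simp
      have lo: "ereal (u' \<bullet> q - ?H q) \<le> ?C u'" by (rule fenchel_conj_ge[OF h(1) q])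
      obtain c where "?C u' = ereal c" using up lo by (cases "?C u'") auto
      then show ?thesis using up lo fenchel_conj_subdiff[OF h(1) u]
        by (simp add: inner_diff_left abs_le_iff)
    qed
    then show "\<exists>d>0. \<forall>y. norm (y - u) < d \<longrightarrow>
      norm (real_of_ereal (?C y) - real_of_ereal (?C u) - (y - u) \<bullet> q) \<le> e * norm (y - u)"
      using e(1) by blast
  qed
qed

text \<open>Finiteness of the conjugate at the points \<open>u + e *\<^sub>R b\<close>, with
  \<open>b\<close> running over the signed basis vectors, gives finitely many affine lower bounds
  for \<open>h\<close>. Averaging them over the basis yields growth at rate
  \<open>e / DIM('a)\<close>, since the l1 norm dominates the Euclidean norm.\<close>

lemma fenchel_conj_coercive:
  fixes h :: "'a::euclidean_space \<Rightarrow> ereal"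
  assumes h: "proper_fun h" and u: "u \<in> interior (edom (fenchel_conj h))"
  shows "\<exists>\<delta>>0. \<exists>M. \<forall>v\<in>edom h. u \<bullet> v + \<delta> * norm v - M \<le> real_of_ereal (h v)"
proof -
  let ?C = "fenchel_conj h" and ?H = "\<lambda>v. real_of_ereal (h v)"
  obtain e where e: "e > 0" "cball u e \<subseteq> edom ?C" using u by (auto simp: mem_interior_cball)
  obtain q where q: "q \<in> edom h" using h by (auto simp: proper_fun_def)
  \<comment> \<open>Both signs of each basis vector are included so that the bounds control
    \<open>\<bar>v \<bullet> b\<bar>\<close>.\<close>
  define B :: "'a set" where "B = Basis \<union> uminus ` Basis"
  define c where "c b = real_of_ereal (?C (u + e *\<^sub>R b))" for b
  define M where "M = Max (c ` B)"
  have fin: "finite B" by (simp add: B_def)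
  have *: "u \<bullet> v + e * (b \<bullet> v) - M \<le> ?H v" if b: "b \<in> B" and v: "v \<in> edom h" for b v
  proof -
    have "norm b = 1" using b by (auto simp: B_def)
    then have "u + e *\<^sub>R b \<in> edom ?C" using e by (intro subsetD[OF e(2)]) (simp add: dist_norm)
    then have "?C (u + e *\<^sub>R b) = ereal (c b)"
      using fenchel_conj_ge[OF h q, of "u + e *\<^sub>R b"]
      by (cases "?C (u + e *\<^sub>R b)") (auto simp: edom_def c_def)
    then have "(u + e *\<^sub>R b) \<bullet> v - ?H v \<le> c b"
      using fenchel_conj_ge[OF h v, of "u + e *\<^sub>R b"] by simp
    also have "c b \<le> M" unfolding M_def using fin b by simp
    finally show ?thesis by (simp add: inner_add_left)
  qed
  have "u \<bullet> v + e / DIM('a) * norm v - M \<le> ?H v" if v: "v \<in> edom h" for v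
  proof -
    have "u \<bullet> v + e * \<bar>v \<bullet> b\<bar> - M \<le> ?H v" if "b \<in> Basis" for b
      using *[of b v] *[of "- b" v] v that by (cases "v \<bullet> b \<ge> 0") (auto simp: B_def inner_commute)
    then have "(\<Sum>b\<in>(Basis::'a set). u \<bullet> v + e * \<bar>v \<bullet> b\<bar> - M) \<le> (\<Sum>b\<in>(Basis::'a set). ?H v)"
      by (intro sum_mono)
    then have "DIM('a) * (u \<bullet> v - M) + e * (\<Sum>b\<in>Basis. \<bar>v \<bullet> b\<bar>) \<le> DIM('a) * ?H v"
      by (simp add: sum.distrib sum_subtractf sum_distrib_left algebra_simps)
    moreover have "e * norm v \<le> e * (\<Sum>b\<in>Basis. \<bar>v \<bullet> b\<bar>)"
      using e norm_le_l1[of v] by (intro mult_left_mono) auto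
    ultimately have "DIM('a) * (u \<bullet> v - M) + e * norm v \<le> DIM('a) * ?H v" by linarith
    then show ?thesis by (simp add: field_simps)
  qed
  then show ?thesis using e by (intro exI[of _ "e / DIM('a)"]) auto
qed

text \<open>By coercivity, \<open>h\<close> minus the linear function with slope \<open>u\<close>
  attains its global minimum, and a minimizer is a point at which \<open>u\<close> is a
  subgradient.\<close>

lemma subdiff_attained_interior_conj:
  fixes h :: "'a::euclidean_space \<Rightarrow> ereal"
  assumes h: "proper_fun h" "lsc_fun h" and u: "u \<in> interior (edom (fenchel_conj h))"
  shows "\<exists>q. u \<in> subdiff h q"
proof -
  let ?H = "\<lambda>v. real_of_ereal (h v)"
  obtain d M where d: "d > 0" and co: "\<And>v. v \<in> edom h \<Longrightarrow> u \<bullet> v + d * norm v - M \<le> ?H v"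
    using fenchel_conj_coercive[OF h(1) u] by blast
  obtain p where p: "p \<in> edom h" using h by (auto simp: proper_fun_def)
  \<comment> \<open>The second entry makes the coercive bound outside the ball at least the value at
    \<open>p\<close>; the first puts \<open>p\<close> into the ball. A minimizer over the ball is
    therefore global.\<close>
  define R where "R = max (norm p) ((?H p - u \<bullet> p + M) / d)"
  have p_in: "p \<in> cball 0 R" by (simp add: R_def)
  then have "cball 0 R \<noteq> ({}::'a set)" by blast
  then have "\<exists>q\<in>cball 0 R. \<forall>v\<in>cball 0 R. h q - ereal (u \<bullet> q) \<le> h v - ereal (u \<bullet> v)"
    by (rule lsc_fun_attains_min[OF lsc_fun_diff_inner[OF h(2)] compact_cball])
  then obtain q where q: "q \<in> cball 0 R"
    "\<And>v. v \<in> cball 0 R \<Longrightarrow> h q - ereal (u \<bullet> q) \<le> h v - ereal (u \<bullet> v)"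
    by blast
  have "h q - ereal (u \<bullet> q) \<le> ereal (?H p - u \<bullet> p)"
    using q(2)[OF p_in] ereal_real_edom[OF h(1) p] by (metis ereal_minus(1))
  then have "q \<in> edom h" by (cases "h q") (auto simp: edom_def)
  have qv: "?H q - u \<bullet> q \<le> ?H v - u \<bullet> v" if "v \<in> edom h" "v \<in> cball 0 R" for v
    using q(2)[OF that(2)] ereal_real_edom[OF h(1) that(1)] ereal_real_edom[OF h(1) \<open>q \<in> edom h\<close>]
    by (metis ereal_less_eq(3) ereal_minus(1))
  have "u \<in> subdiff h q"
  proof (rule subdiffI_real[OF h(1) \<open>q \<in> edom h\<close>])
    fix v assume v: "v \<in> edom h"
    have "?H q - u \<bullet> q \<le> ?H v - u \<bullet> v"
    proof (cases "v \<in> cball 0 R")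
      case False
      then have "(?H p - u \<bullet> p + M) / d \<le> norm v" by (auto simp: R_def)
      then have "?H p - u \<bullet> p + M \<le> d * norm v" using d by (simp add: divide_le_eq mult.commute)
      then show ?thesis using co[OF v] qv[OF p p_in] by linarith
    qed (use qv v in blast)
    then show "?H q + u \<bullet> (v - q) \<le> ?H v" by (simp add: inner_diff_right)
  qed
  then show ?thesis by blast
qed

section \<open>Legendre functions: the two gradient maps invert each other\<close>

lemma legendreD:
  fixes h :: "'a::euclidean_space \<Rightarrow> ereal"
  assumes "legendre h"
  shows "proper_fun h" "lsc_fun h" "strictly_convex_fun h" "convex_fun h"
    and "p \<in> interior (edom h) \<Longrightarrow> (\<lambda>y. real_of_ereal (h y)) differentiable (at p)"
  using assms strictly_convex_imp_convex_fun unfolding legendre_def essentially_smooth_def by auto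

lemma legendre_grad_subdiff:
  fixes h :: "'a::euclidean_space \<Rightarrow> ereal"
  assumes "legendre h" "p \<in> interior (edom h)"
  shows "grad h p \<in> subdiff h p"
  using grad_in_subdiff legendreD[OF assms(1)] assms(2) by blast

lemma legendre_grad_conj_grad:
  fixes h :: "'a::euclidean_space \<Rightarrow> ereal"
  assumes "legendre h" "p \<in> interior (edom h)"
  shows "grad h p \<in> interior (edom (fenchel_conj h))"
    and "grad (fenchel_conj h) (grad h p) = p"
  using fenchel_conj_GDERIV[OF legendreD(1-3)[OF assms(1)] legendre_grad_subdiff[OF assms]]
  by (auto intro: grad_eqI)

text \<open>The supremum defining the conjugate at \<open>u\<close> is attained at some
  \<open>q\<close>, and the derivative formula identifies \<open>q\<close> with the conjugate
  gradient. As \<open>q\<close> is interior to the domain of \<open>h\<close>, its subgradient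
  \<open>u\<close> must be the gradient there.\<close>

lemma legendre_grad_grad_conj:
  fixes h :: "'a::euclidean_space \<Rightarrow> ereal"
  assumes h: "legendre h" and u: "u \<in> interior (edom (fenchel_conj h))"
    and "grad (fenchel_conj h) u \<in> interior (edom h)"
  shows "grad h (grad (fenchel_conj h) u) = u"
proof -
  note h' = legendreD[OF h]
  obtain q where q: "u \<in> subdiff h q" using subdiff_attained_interior_conj[OF h'(1,2) u] by blast
  then have "grad (fenchel_conj h) u = q"
    using fenchel_conj_GDERIV(2)[OF h'(1-3)] grad_eqI by blast
  then show ?thesis using subdiff_eq_grad[OF h'(1) _ h'(5) q] assms(3) by simp
qed

text \<open>This turns each mirror update into a linear relation between gradients of
  \<open>h\<close>, so that the substeps of an iteration can be added up.\<close>

lemma legendre_mirror_image: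
  fixes h :: "'a::euclidean_space \<Rightarrow> ereal"
  assumes "legendre h" "is_mirror_image h u p" "p \<in> interior (edom h)"
  shows "grad h p = u"
  using legendre_grad_grad_conj[OF assms(1)] assms(2,3) unfolding is_mirror_image_def by auto

subsection \<open>One step of the splitting method\<close>

lemma bregman_eq_real:
  assumes "proper_fun h" "v \<in> edom h" "p \<in> edom h"
  shows "bregman h v p
    = ereal (real_of_ereal (h v) - real_of_ereal (h p) - grad h p \<bullet> (v - p))"
  unfolding bregman_def using ereal_real_edom[OF assms(1)] assms(2,3) by (metis ereal_minus(1))

text \<open>First-order optimality, from the one-sided derivative of the objective along a segment.\<close>

lemma bregman_prox_subdiff:
  fixes h f :: "'a::euclidean_space \<Rightarrow> ereal"
  assumes h: "legendre h" and f: "proper_fun f" "convex_fun f" and \<gamma>: "\<gamma> > 0"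
    and x: "x \<in> interior (edom h)" and w: "w \<in> interior (edom h)" "w \<in> edom f"
    and prox: "bregman_prox h f \<gamma> x w"
  shows "(1 / \<gamma>) *\<^sub>R (grad h x - grad h w) \<in> subdiff f w"
proof (rule subdiffI_real[OF f(1) w(2)])
  fix y assume y: "y \<in> edom f"
  let ?H = "\<lambda>v. real_of_ereal (h v)" and ?F = "\<lambda>v. real_of_ereal (f v)"
  note h' = legendreD[OF h]
  define d where "d = y - w"
  \<comment> \<open>An upper bound for the change of the proximal objective along the segment from
    \<open>w\<close> to \<open>y\<close>: \<open>f\<close> is replaced by its chord, which makes the
    bound differentiable at 0 even when \<open>f\<close> is not.\<close>
  define \<theta> where "\<theta> \<tau> = (1 / \<gamma>) * (?H (w + \<tau> *\<^sub>R d) - ?H w - \<tau> * (grad h x \<bullet> d)) + \<tau> * (?F y - ?F w)"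
    for \<tau> :: real
  have xd: "x \<in> edom h" and wd: "w \<in> edom h" using x w interior_subset by auto
  have "\<exists>e>0. ball w e \<subseteq> edom h" using w(1) by (auto simp: mem_interior)
  then obtain e where e: "e > 0" "ball w e \<subseteq> edom h" by blast
  \<comment> \<open>Below \<open>t0\<close> the segment stays between \<open>w\<close> and
    \<open>y\<close>, hence in the domain of \<open>f\<close>, and inside the ball, hence in the
    domain of \<open>h\<close>. Adding 1 to the norm covers the case \<open>y = w\<close>.\<close>
  define t0 where "t0 = min 1 (e / (norm d + 1))"
  have np: "norm d + 1 > 0" using norm_ge_zero[of d] by linarith
  then have t0: "t0 > 0" using e by (simp add: t0_def)
  have nonneg: "\<theta> 0 \<le> \<theta> \<tau>" if \<tau>: "0 < \<tau>" "\<tau> < t0" for \<tau>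
  proof -
    let ?p = "w + \<tau> *\<^sub>R d"
    have p_eq: "?p = (1 - \<tau>) *\<^sub>R w + \<tau> *\<^sub>R y" by (simp add: d_def algebra_simps)
    have "\<tau> \<le> 1" using \<tau> by (simp add: t0_def)
    then have pf: "?p \<in> edom f" and Fp: "?F ?p \<le> (1 - \<tau>) * ?F w + \<tau> * ?F y"
      unfolding p_eq using f w(2) y \<tau> by (auto intro!: edom_convex_comb convex_fun_real')
    have "\<tau> * (norm d + 1) < e" using \<tau> np by (simp add: t0_def less_divide_eq)
    then have "\<tau> * norm d < e" using \<tau> by (simp add: algebra_simps)
    then have "?p \<in> ball w e" using \<tau> by (simp add: dist_norm)
    then have ph: "?p \<in> edom h" using e by blast
    have "f w + ereal (1 / \<gamma>) * bregman h w x \<le> f ?p + ereal (1 / \<gamma>) * bregman h ?p x"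
      using prox unfolding bregman_prox_def is_arg_min_linorder by blast
    then have "?F w + (1 / \<gamma>) * (?H w - ?H x - grad h x \<bullet> (w - x))
      \<le> ?F ?p + (1 / \<gamma>) * (?H ?p - ?H x - grad h x \<bullet> (?p - x))"
      unfolding bregman_eq_real[OF h'(1) wd xd] bregman_eq_real[OF h'(1) ph xd]
      using ereal_real_edom[OF f(1) w(2)] ereal_real_edom[OF f(1) pf]
      by (metis ereal_less_eq(3) plus_ereal.simps(1) times_ereal.simps(1))
    then have "0 \<le> ?F ?p - ?F w + (1 / \<gamma>) * (?H ?p - ?H w - \<tau> * (grad h x \<bullet> d))"
      by (simp add: inner_diff_right inner_add_right algebra_simps)
    then show ?thesis using Fp by (simp add: \<theta>_def algebra_simps)
  qed
  have "(?H has_derivative (\<lambda>v. v \<bullet> grad h w)) (at (w + 0 *\<^sub>R d))"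
    using GDERIV_grad[OF h'(5)[OF w(1)]] by (simp add: gderiv_def)
  then have "((\<lambda>\<tau>. ?H (w + \<tau> *\<^sub>R d)) has_derivative (\<lambda>\<tau>. (0 + \<tau> *\<^sub>R d) \<bullet> grad h w)) (at 0)"
    by (rule has_derivative_compose[rotated]) (auto intro!: derivative_eq_intros)
  then have "((\<lambda>\<tau>. ?H (w + \<tau> *\<^sub>R d)) has_real_derivative (d \<bullet> grad h w)) (at 0)"
    by (simp add: has_field_derivative_def mult_commute_abs)
  then have der: "(\<theta> has_real_derivative
      ((1 / \<gamma>) * (d \<bullet> grad h w - grad h x \<bullet> d) + (?F y - ?F w))) (at 0)"
    unfolding \<theta>_def using \<gamma> by (auto intro!: derivative_eq_intros)
  have "0 \<le> (1 / \<gamma>) * (d \<bullet> grad h w - grad h x \<bullet> d) + (?F y - ?F w)"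
  proof (rule ccontr)
    assume "\<not> ?thesis"
    then obtain r where r: "r > 0" "\<And>k. 0 < k \<Longrightarrow> k < r \<Longrightarrow> \<theta> 0 > \<theta> (0 + k)"
      using DERIV_neg_dec_right[OF der] by auto
    define k where "k = min r t0 / 2"
    have "0 < k" "k < r" "k < t0" using r t0 by (auto simp: k_def)
    then show False using r(2)[of k] nonneg[of k] by simp
  qed
  then show "?F w + ((1 / \<gamma>) *\<^sub>R (grad h x - grad h w)) \<bullet> (y - w) \<le> ?F y"
    by (simp add: d_def inner_commute algebra_simps)
qed

text \<open>The optimality condition read in dual coordinates: a proximal step is an implicit
  subgradient step for \<open>grad h\<close>.\<close>

lemma legendre_prox_step:
  fixes h f :: "'a::euclidean_space \<Rightarrow> ereal"
  assumes "legendre h" "proper_fun f" "convex_fun f" "\<gamma> > 0"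
    and "x \<in> interior (edom h)" "w \<in> interior (edom h)" "w \<in> edom f"
    and "bregman_prox h f \<gamma> x w"
  obtains s where "s \<in> subdiff f w" "grad h w = grad h x - \<gamma> *\<^sub>R s"
proof
  show "(1 / \<gamma>) *\<^sub>R (grad h x - grad h w) \<in> subdiff f w"
    using bregman_prox_subdiff assms by blast
  show "grad h w = grad h x - \<gamma> *\<^sub>R ((1 / \<gamma>) *\<^sub>R (grad h x - grad h w))"
    using assms(4) by simp
qed

text \<open>Moving the base point from \<open>w\<close> to \<open>p\<close> costs
  \<open>C * norm (w - p)\<close> twice: once for the inner product with \<open>s\<close>, once for
  replacing \<open>f w\<close> by \<open>f p\<close> through the subgradient \<open>v\<close> at
  \<open>p\<close>.\<close>

lemma subdiff_bounded_shift:
  assumes f: "proper_fun f" and s: "s \<in> subdiff f w" "norm s \<le> C"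
    and v: "v \<in> subdiff f p" "norm v \<le> C" and a: "a \<in> edom f"
  shows "s \<bullet> (a - p) \<le> real_of_ereal (f a) - real_of_ereal (f p) + 2 * C * norm (w - p)"
proof -
  have "s \<bullet> (w - p) \<le> C * norm (w - p)"
    using norm_cauchy_schwarz[of s "w - p"] mult_right_mono[OF s(2), of "norm (w - p)"] by simp
  moreover have "- (v \<bullet> (w - p)) \<le> C * norm (w - p)"
    using norm_cauchy_schwarz[of "- v" "w - p"] mult_right_mono[OF v(2), of "norm (w - p)"] by simp
  moreover have "s \<bullet> (a - p) = s \<bullet> (a - w) + s \<bullet> (w - p)" by (simp add: inner_diff_right)
  moreover note subdiff_real[OF f s(1) a] subdiff_real[OF f v(1) subdiff_edom[OF f s(1)]]
  ultimately show ?thesis by linarith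
qed

text \<open>A real-valued form of \<open>bregman\<close>, equal to it when both points lie in the
  domain of a proper \<open>h\<close>, so that the descent argument can use real arithmetic.\<close>

definition rbregman :: "('a::real_inner \<Rightarrow> ereal) \<Rightarrow> 'a \<Rightarrow> 'a \<Rightarrow> real" where
  "rbregman h a p = real_of_ereal (h a) - real_of_ereal (h p) - grad h p \<bullet> (a - p)"

lemma rbregman_nonneg:
  fixes h :: "'a::euclidean_space \<Rightarrow> ereal"
  assumes "legendre h" "a \<in> edom h" "p \<in> interior (edom h)"
  shows "0 \<le> rbregman h a p"
  using subdiff_real[OF legendreD(1)[OF assms(1)] legendre_grad_subdiff[OF assms(1,3)] assms(2)]
  by (simp add: rbregman_def)

text \<open>The three-point identity for Bregman distances with the nonnegative term
  \<open>rbregman h p' p\<close> dropped.\<close>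

lemma rbregman_step:
  fixes h :: "'a::euclidean_space \<Rightarrow> ereal"
  assumes "legendre h" "p \<in> interior (edom h)" "p' \<in> interior (edom h)"
  shows "rbregman h a p' \<le> rbregman h a p + (grad h p - grad h p') \<bullet> (a - p')"
proof -
  have "rbregman h a p + (grad h p - grad h p') \<bullet> (a - p') = rbregman h a p' + rbregman h p' p"
    by (simp add: rbregman_def inner_diff_left inner_diff_right)
  then show ?thesis using rbregman_nonneg[of h p' p] assms interior_subset by fastforce
qed

text \<open>Each interior point is the conjugate gradient of its own gradient, so the Lipschitz
  bound controls primal distances by dual ones.\<close>

lemma legendre_dist_le:
  fixes h :: "'a::euclidean_space \<Rightarrow> ereal"
  assumes "legendre h" "p \<in> interior (edom h)" "q \<in> interior (edom h)"
    and L: "L-lipschitz_on (interior (edom (fenchel_conj h))) (grad (fenchel_conj h))"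
  shows "norm (p - q) \<le> L * norm (grad h p - grad h q)"
  using lipschitz_onD[OF L legendre_grad_conj_grad(1)[OF assms(1,2)] legendre_grad_conj_grad(1)[OF assms(1,3)]]
  by (simp add: legendre_grad_conj_grad(2)[OF assms(1)] assms(2,3) dist_norm)

text \<open>Every interior point of the domain of \<open>h\<close> is a value of the conjugate
  gradient, hence lies in the domain of \<open>f\<close>. The interior is open, so it even lies in
  the interior of that domain.\<close>

lemma subdiff_nonempty_interior_legendre:
  fixes h f :: "'a::euclidean_space \<Rightarrow> ereal"
  assumes "legendre h" "proper_fun f" "convex_fun f"
    and "grad (fenchel_conj h) ` interior (edom (fenchel_conj h)) \<subseteq> edom f"
    and "p \<in> interior (edom h)"
  shows "p \<in> edom f" "subdiff f p \<noteq> {}"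
proof -
  have "interior (edom h) \<subseteq> edom f"
    using legendre_grad_conj_grad[OF assms(1)] assms(4) by (metis image_subset_iff subsetI)
  then have "interior (edom h) \<subseteq> interior (edom f)" by (simp add: interior_maximal)
  then have p: "p \<in> interior (edom f)" using assms(5) by blast
  then show "p \<in> edom f" using interior_subset by blast
  show "subdiff f p \<noteq> {}" by (rule subdiff_nonempty_interior[OF assms(2,3) p])
qed

lemma bdrs_step:
  fixes h f g :: "'a::euclidean_space \<Rightarrow> ereal"
  assumes h: "legendre h" and f: "proper_fun f" "convex_fun f" and g: "proper_fun g" "convex_fun g"
    and im: "grad (fenchel_conj h) ` interior (edom (fenchel_conj h)) \<subseteq> edom f \<inter> edom g"
    and Cf: "\<And>p v. v \<in> subdiff f p \<Longrightarrow> norm v \<le> C"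
    and Cg: "\<And>p v. v \<in> subdiff g p \<Longrightarrow> norm v \<le> C"
    and L: "L-lipschitz_on (interior (edom (fenchel_conj h))) (grad (fenchel_conj h))"
    and a: "a \<in> edom f" "a \<in> edom g"
    and \<gamma>: "\<gamma> > 0"
    and int: "{x, w, xbar, z, y, x'} \<subseteq> interior (edom h)"
    and w: "bregman_prox h f \<gamma> x w" and s: "s \<in> subdiff f w"
    and xbar: "is_mirror_image h (grad h w - \<gamma> *\<^sub>R s) xbar"
    and z: "bregman_prox h g \<gamma> xbar z" and t: "t \<in> subdiff g z"
    and y: "is_mirror_image h (grad h z - \<gamma> *\<^sub>R t) y"
    and x': "is_mirror_image h ((1/2) *\<^sub>R grad h x + (1/2) *\<^sub>R grad h y) x'"
  shows "rbregman h a x' \<le> rbregman h a x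
    - \<gamma> * (real_of_ereal (f x') + real_of_ereal (g x') - (real_of_ereal (f a) + real_of_ereal (g a)))
    + 8 * L * C\<^sup>2 * \<gamma>\<^sup>2"
proof -
  let ?F = "\<lambda>v. real_of_ereal (f v)" and ?G = "\<lambda>v. real_of_ereal (g v)"
  have imf: "grad (fenchel_conj h) ` interior (edom (fenchel_conj h)) \<subseteq> edom f"
    and img: "grad (fenchel_conj h) ` interior (edom (fenchel_conj h)) \<subseteq> edom g" using im by auto
  note mf = subdiff_nonempty_interior_legendre[OF h f imf]
  note mg = subdiff_nonempty_interior_legendre[OF h g img]
  obtain s' where s': "s' \<in> subdiff f w" and gw: "grad h w = grad h x - \<gamma> *\<^sub>R s'"
    using legendre_prox_step[OF h f \<gamma> _ _ _ w] mf int by auto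
  obtain t' where t': "t' \<in> subdiff g z" and gz: "grad h z = grad h xbar - \<gamma> *\<^sub>R t'"
    using legendre_prox_step[OF h g \<gamma> _ _ _ z] mg int by auto
  have gxbar: "grad h xbar = grad h w - \<gamma> *\<^sub>R s" using legendre_mirror_image[OF h xbar] int by simp
  have gy: "grad h y = grad h z - \<gamma> *\<^sub>R t" using legendre_mirror_image[OF h y] int by simp
  \<comment> \<open>The two proximal and two reflection steps each subtract \<gamma> times a
    subgradient; averaging with \<open>grad h x\<close> halves the total.\<close>
  have gx': "grad h x' = grad h x - (\<gamma> / 2) *\<^sub>R (s + s' + t + t')"
  proof -
    have "grad h x' = (1/2) *\<^sub>R grad h x + (1/2) *\<^sub>R grad h y"
      using legendre_mirror_image[OF h x'] int by simp
    moreover have "grad h y = grad h x - \<gamma> *\<^sub>R (s + s' + t + t')"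
      by (simp add: gy gz gxbar gw algebra_simps)
    ultimately show ?thesis
      by (simp add: algebra_simps flip: scaleR_left_distrib)
  qed
  note C = Cf[OF s] Cf[OF s'] Cg[OF t] Cg[OF t']
  have L0: "0 \<le> L" using L by (rule lipschitz_on_nonneg)
  have C0: "0 \<le> C" using C(1) norm_ge_zero[of s] by linarith
  have four: "norm (a1 + a2 + a3 + a4) \<le> 4 * C"
    if "norm a1 \<le> C" "norm a2 \<le> C" "norm a3 \<le> C" "norm a4 \<le> C" for a1 a2 a3 a4 :: 'a
    using that norm_triangle_ineq[of "a1 + a2 + a3" a4] norm_triangle_ineq[of "a1 + a2" a3]
      norm_triangle_ineq[of a1 a2] by linarith
  \<comment> \<open>A dual displacement of \<gamma>/2 times a sum of four vectors of norm at most
    \<open>C\<close> has norm at most \<open>2 * C * \<gamma>\<close>; the Lipschitz constant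
    carries this over to the points.\<close>
  have near: "norm (p - x') \<le> 2 * L * C * \<gamma>"
    if "p \<in> interior (edom h)" and eq: "grad h p - grad h x' = (\<gamma> / 2) *\<^sub>R e" and e: "norm e \<le> 4 * C"
    for p e
  proof -
    have "norm (p - x') \<le> L * norm (grad h p - grad h x')"
      using legendre_dist_le[OF h that(1) _ L, of x'] int by blast
    also have "norm (grad h p - grad h x') \<le> \<gamma> / 2 * (4 * C)"
      unfolding eq using \<gamma> e by (simp add: mult_left_mono)
    then have "L * norm (grad h p - grad h x') \<le> L * (\<gamma> / 2 * (4 * C))"
      using L0 by (rule mult_left_mono)
    finally show ?thesis by (simp add: algebra_simps)
  qed
  \<comment> \<open>Doubling \<open>v\<close> gives all dual displacements the common factor
    \<gamma>/2, so each becomes a signed sum of the four subgradients.\<close>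
  have half: "\<gamma> *\<^sub>R v = (\<gamma> / 2) *\<^sub>R (v + v)" for v :: 'a
    by (simp add: scaleR_add_right flip: scaleR_left_distrib)
  have wx: "norm (w - x') \<le> 2 * L * C * \<gamma>"
  proof (rule near)
    show "grad h w - grad h x' = (\<gamma> / 2) *\<^sub>R (s + (- s') + t + t')"
      unfolding gw gx' half by (simp add: algebra_simps)
    show "norm (s + (- s') + t + t') \<le> 4 * C" using C by (intro four) auto
  qed (use int in simp)
  have zx: "norm (z - x') \<le> 2 * L * C * \<gamma>"
  proof (rule near)
    show "grad h z - grad h x' = (\<gamma> / 2) *\<^sub>R ((- s) + (- s') + t + (- t'))"
      unfolding gz gxbar gw gx' half by (simp add: algebra_simps)
    show "norm ((- s) + (- s') + t + (- t')) \<le> 4 * C" using C by (intro four) auto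
  qed (use int in simp)
  obtain vf where vf: "vf \<in> subdiff f x'" using mf(2) int by auto
  obtain vg where vg: "vg \<in> subdiff g x'" using mg(2) int by auto
  \<comment> \<open>The cost of moving one subgradient inequality to \<open>x'\<close>. Four such
    costs, weighted by \<gamma>/2, make up the final error
    \<open>8 * L * C\<^sup>2 * \<gamma>\<^sup>2\<close>.\<close>
  let ?E = "2 * C * (2 * L * C * \<gamma>)"
  have wx': "2 * C * norm (w - x') \<le> ?E" using C0 by (intro mult_left_mono[OF wx]) simp
  have zx': "2 * C * norm (z - x') \<le> ?E" using C0 by (intro mult_left_mono[OF zx]) simp
  have "s \<bullet> (a - x') \<le> ?F a - ?F x' + ?E" "s' \<bullet> (a - x') \<le> ?F a - ?F x' + ?E"
    using subdiff_bounded_shift[OF f(1) s C(1) vf Cf[OF vf] a(1)]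
      subdiff_bounded_shift[OF f(1) s' C(2) vf Cf[OF vf] a(1)] wx' by linarith+
  moreover have "t \<bullet> (a - x') \<le> ?G a - ?G x' + ?E" "t' \<bullet> (a - x') \<le> ?G a - ?G x' + ?E"
    using subdiff_bounded_shift[OF g(1) t C(3) vg Cg[OF vg] a(2)]
      subdiff_bounded_shift[OF g(1) t' C(4) vg Cg[OF vg] a(2)] zx' by linarith+
  ultimately have "(s + s' + t + t') \<bullet> (a - x')
      \<le> 2 * (?F a + ?G a - (?F x' + ?G x')) + 4 * ?E"
    by (simp add: inner_add_left)
  then have "(\<gamma> / 2) * ((s + s' + t + t') \<bullet> (a - x'))
      \<le> (\<gamma> / 2) * (2 * (?F a + ?G a - (?F x' + ?G x')) + 4 * ?E)"
    using \<gamma> by (intro mult_left_mono) auto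
  also have "\<dots> = - \<gamma> * (?F x' + ?G x' - (?F a + ?G a)) + 8 * L * C\<^sup>2 * \<gamma>\<^sup>2"
    by (simp add: algebra_simps power2_eq_square)
  finally have "(grad h x - grad h x') \<bullet> (a - x')
      \<le> - \<gamma> * (?F x' + ?G x' - (?F a + ?G a)) + 8 * L * C\<^sup>2 * \<gamma>\<^sup>2"
    by (simp add: gx')
  then show ?thesis using rbregman_step[OF h, of x x' a] int by simp
qed

subsection \<open>Convergence rate\<close>

text \<open>The difference of the harmonic number and the logarithm is decreasing and equals 1 at
  index 1.\<close>

lemma sum_inverse_le_ln:
  assumes "N \<ge> 1"
  shows "(\<Sum>k=1..N. 1 / real k) \<le> 1 + ln (real N)"
proof -
  have "harm (Suc (N - 1)) - ln (real (Suc (N - 1))) \<le> harm (Suc 0) - ln (real (Suc 0))"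
    by (rule decseqD[OF decseq_harm_diff_ln]) simp
  then show ?thesis using assms by (simp add: harm_def inverse_eq_divide)
qed

lemma sqrt_le_sum_inverse_sqrt:
  assumes "N \<ge> 1"
  shows "sqrt (real N) \<le> (\<Sum>k=1..N. 1 / sqrt (real k))"
proof -
  have "sqrt (real N) = (\<Sum>k=1..N. 1 / sqrt (real N))" by (simp add: real_div_sqrt)
  also have "\<dots> \<le> (\<Sum>k=1..N. 1 / sqrt (real k))" by (intro sum_mono divide_left_mono) auto
  finally show ?thesis .
qed

text \<open>Telescoping bounds the weighted sum of the \<open>\<phi> k\<close> by \<open>d 1\<close>
  plus \<open>B\<close> times a harmonic sum. Since \<open>b\<close> is nonnegative and below each
  \<open>\<phi> k\<close>, and the weights sum to at least \<open>sqrt (real N)\<close>, division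
  gives the rate.\<close>

lemma inverse_sqrt_step_rate:
  fixes d \<phi> :: "nat \<Rightarrow> real"
  assumes d: "\<And>k. k \<ge> 1 \<Longrightarrow> 0 \<le> d k" and B: "B \<ge> 0"
    and step: "\<And>k. k \<ge> 1 \<Longrightarrow> d (Suc k) \<le> d k - (1 / sqrt (real k)) * \<phi> k + B * (1 / real k)"
    and b: "0 \<le> b" "\<And>k. k \<in> {1..N} \<Longrightarrow> b \<le> \<phi> k" and N: "N \<ge> 1"
  shows "b \<le> (d 1 + B * (1 + ln (real N))) / sqrt (real N)"
proof -
  have tele: "d (Suc M) + (\<Sum>k=1..M. (1 / sqrt (real k)) * \<phi> k) \<le> d 1 + B * (\<Sum>k=1..M. 1 / real k)" for M
  proof (induction M)
    case (Suc M)
    then show ?case using step[of "Suc M"] by (simp add: algebra_simps)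
  qed simp
  have "b * sqrt (real N) \<le> b * (\<Sum>k=1..N. 1 / sqrt (real k))"
    using sqrt_le_sum_inverse_sqrt[OF N] b(1) by (rule mult_left_mono)
  also have "\<dots> \<le> (\<Sum>k=1..N. (1 / sqrt (real k)) * \<phi> k)"
    unfolding sum_distrib_left using b(2) by (intro sum_mono) (simp add: divide_right_mono)
  also have "\<dots> \<le> d 1 + B * (\<Sum>k=1..N. 1 / real k)" using tele[of N] d[of "Suc N"] by simp
  also have "\<dots> \<le> d 1 + B * (1 + ln (real N))"
    using sum_inverse_le_ln[OF N] B by (simp add: mult_left_mono)
  finally show ?thesis using N by (simp add: le_divide_eq)
qed

lemma ln_over_sqrt_rate:
  fixes A B :: real and b :: "nat \<Rightarrow> real"
  assumes "\<And>N. N \<ge> 1 \<Longrightarrow> 0 \<le> b N" "\<And>N. N \<ge> 1 \<Longrightarrow> b N \<le> (A + B * (1 + ln (real N))) / sqrt (real N)"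
  shows "b \<longlonglongrightarrow> 0" "b \<in> O(\<lambda>N. ln (real N) / sqrt (real N))"
proof -
  let ?u = "\<lambda>N. (A + B * (1 + ln (real N))) / sqrt (real N)"
  have nonneg: "eventually (\<lambda>N. 0 \<le> b N) sequentially" and le: "eventually (\<lambda>N. b N \<le> ?u N) sequentially"
    using assms by (auto intro: eventually_mono[OF eventually_ge_at_top[of 1]])
  have "?u \<longlonglongrightarrow> 0" by real_asymp
  with nonneg le show "b \<longlonglongrightarrow> 0" by (rule tendsto_sandwich[OF _ _ tendsto_const])
  from nonneg le have "eventually (\<lambda>N. norm (b N) \<le> norm (?u N)) sequentially"
    by eventually_elim (unfold real_norm_def, linarith)
  then have "b \<in> O(?u)" by (rule landau_o.big_mono)
  also have "?u \<in> O(\<lambda>N. ln (real N) / sqrt (real N))"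
    by real_asymp
  finally show "b \<in> O(\<lambda>N. ln (real N) / sqrt (real N))" .
qed

text \<open>Passage from extended to real arithmetic: for \<open>N \<ge> 1\<close> the gap is a
  difference of finite values, attained at one of the iterates and nonnegative by minimality of
  \<open>xs\<close>.\<close>

lemma best_gap_real:
  assumes f: "proper_fun f" and g: "proper_fun g"
    and min: "is_arg_min (\<lambda>p. f p + g p) (\<lambda>_. True) xs"
    and x: "\<And>k. k \<ge> 1 \<Longrightarrow> x (Suc k) \<in> edom f \<inter> edom g" and N: "N \<ge> 1"
  defines "\<Phi> \<equiv> \<lambda>p. real_of_ereal (f p) + real_of_ereal (g p)"
  shows "xs \<in> edom f \<inter> edom g"
    and "\<exists>b. best_gap f g x xs N = ereal b \<and> 0 \<le> b \<and> (\<forall>k\<in>{1..N}. b \<le> \<Phi> (x (Suc k)) - \<Phi> xs)"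
proof -
  have fin: "f p + g p = ereal (\<Phi> p)" if "p \<in> edom f \<inter> edom g" for p
    unfolding \<Phi>_def using ereal_real_edom[OF f, of p] ereal_real_edom[OF g, of p] that
    by (metis IntE plus_ereal.simps(1))
  have le: "f xs + g xs \<le> f p + g p" for p
    using min unfolding is_arg_min_linorder by blast
  \<comment> \<open>Comparison with the iterate at index 2 makes the optimal value finite; as
    neither summand is -\<infinity>, both are then finite at \<open>xs\<close>.\<close>
  have "f xs + g xs < \<infinity>" using le[of "x (Suc 1)"] fin[OF x[of 1]] by (auto intro: le_less_trans)
  then show xs: "xs \<in> edom f \<inter> edom g"
    using f g by (cases "f xs"; cases "g xs") (auto simp: edom_def proper_fun_def)
  define S where "S = (\<lambda>k. f (x (k + 1)) + g (x (k + 1))) ` {1..N}"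
  have S: "finite S" "S \<noteq> {}" using N by (auto simp: S_def)
  then have "Min S \<in> S" by simp
  then obtain i where i: "i \<in> {1..N}" "Min S = f (x (Suc i)) + g (x (Suc i))" by (auto simp: S_def)
  have Mi: "Min S = ereal (\<Phi> (x (Suc i)))" using i fin[OF x[of i]] by simp
  have "best_gap f g x xs N = ereal (\<Phi> (x (Suc i)) - \<Phi> xs)"
    unfolding best_gap_def S_def[symmetric] Mi fin[OF xs] by simp
  moreover have "\<Phi> xs \<le> \<Phi> (x (Suc i))" using le[of "x (Suc i)"] fin[OF xs] fin[OF x[of i]] i by simp
  moreover have "\<Phi> (x (Suc i)) \<le> \<Phi> (x (Suc k))" if k: "k \<in> {1..N}" for k
  proof -
    have "Min S \<le> f (x (Suc k)) + g (x (Suc k))" using S k by (intro Min_le) (auto simp: S_def)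
    then show ?thesis using Mi fin[OF x[of k]] k by simp
  qed
  ultimately show "\<exists>b. best_gap f g x xs N = ereal b \<and> 0 \<le> b \<and> (\<forall>k\<in>{1..N}. b \<le> \<Phi> (x (Suc k)) - \<Phi> xs)"
    by (intro exI[of _ "\<Phi> (x (Suc i)) - \<Phi> xs"]) auto
qed

theorem theoremB1:
  fixes h f g :: "real ^ 'n \<Rightarrow> ereal"
    and x w xbar z y s t :: "nat \<Rightarrow> real ^ 'n"
    and xs :: "real ^ 'n"
    and G \<sigma> :: real
  assumes "legendre h"
    and "proper_fun f" and "closed_fun f" and "convex_fun f"
    and "proper_fun g" and "closed_fun g" and "convex_fun g"
    and "grad (fenchel_conj h) ` interior (edom (fenchel_conj h)) \<subseteq> edom f \<inter> edom g"
    and "G > 0"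
    and "\<And>p v. v \<in> subdiff f p \<Longrightarrow> infnorm v \<le> G"
    and "\<And>p v. v \<in> subdiff g p \<Longrightarrow> infnorm v \<le> G"
    and "\<sigma> > 0" and "strongly_convex_on_simplex \<sigma> h"
    and "\<exists>L. L-lipschitz_on (interior (edom (fenchel_conj h))) (grad (fenchel_conj h))"
    and "is_arg_min (\<lambda>p. f p + g p) (\<lambda>_. True) xs" and "xs \<in> edom h"
    and "bdrs h f g (\<lambda>k. 1 / sqrt (real k)) x w xbar z y s t"
    and "\<And>k. k \<ge> 1 \<Longrightarrow> {x k, w k, xbar k, z k, y k} \<subseteq> interior (edom h)"
  shows "best_gap f g x xs \<longlonglongrightarrow> 0 \<and>
    (\<lambda>N. real_of_ereal (best_gap f g x xs N)) \<in> O(\<lambda>N. ln (real N) / sqrt (real N))"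
proof -
  note h = assms(1) and f = assms(2,4) and g = assms(5,7) and im = assms(8)
    and int = assms(18)
  \<comment> \<open>The square root of the dimension converts the bound in the maximum norm into a
    Euclidean one.\<close>
  define C where "C = sqrt DIM(real ^ 'n) * G"
  have norm_C: "norm v \<le> C" if "infnorm v \<le> G" for v :: "real ^ 'n"
    using norm_le_infnorm[of v] mult_left_mono[OF that, of "sqrt DIM(real ^ 'n)"]
    unfolding C_def by (meson order_trans real_sqrt_ge_zero of_nat_0_le_iff)
  have Cf: "norm v \<le> C" if "v \<in> subdiff f p" for p v using assms(10) that norm_C by blast
  have Cg: "norm v \<le> C" if "v \<in> subdiff g p" for p v using assms(11) that norm_C by blast
  obtain L where L: "L-lipschitz_on (interior (edom (fenchel_conj h))) (grad (fenchel_conj h))"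
    using assms(14) by blast
  have xint: "x k \<in> interior (edom h)" if "k \<ge> 1" for k using int[OF that] by simp
  have dom: "x (Suc k) \<in> edom f \<inter> edom g" for k
    using subdiff_nonempty_interior_legendre(1)[OF h f] subdiff_nonempty_interior_legendre(1)[OF h g]
      xint[of "Suc k"] im by auto
  define \<Phi> where "\<Phi> p = real_of_ereal (f p) + real_of_ereal (g p)" for p
  note gap = best_gap_real[OF f(1) g(1) assms(15), where x = x, OF dom, folded \<Phi>_def]
  have xs: "xs \<in> edom f" "xs \<in> edom g" using gap(1)[of 1] by auto
  define b where "b N = real_of_ereal (best_gap f g x xs N)" for N
  have b: "best_gap f g x xs N = ereal (b N)" "0 \<le> b N" "\<And>k. k \<in> {1..N} \<Longrightarrow> b N \<le> \<Phi> (x (Suc k)) - \<Phi> xs"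
    if "N \<ge> 1" for N
    using gap(2)[OF that] by (auto simp: b_def)
  define B where "B = 8 * L * C\<^sup>2"
  have B: "B \<ge> 0" using lipschitz_on_nonneg[OF L] by (simp add: B_def)
  have step: "rbregman h xs (x (Suc k)) \<le> rbregman h xs (x k)
      - (1 / sqrt (real k)) * (\<Phi> (x (Suc k)) - \<Phi> xs) + B * (1 / real k)" if k: "k \<ge> 1" for k
  proof -
    have it: "bregman_prox h f (1 / sqrt (real k)) (x k) (w k)" "s k \<in> subdiff f (w k)"
      "is_mirror_image h (grad h (w k) - (1 / sqrt (real k)) *\<^sub>R s k) (xbar k)"
      "bregman_prox h g (1 / sqrt (real k)) (xbar k) (z k)" "t k \<in> subdiff g (z k)"
      "is_mirror_image h (grad h (z k) - (1 / sqrt (real k)) *\<^sub>R t k) (y k)"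
      "is_mirror_image h ((1/2) *\<^sub>R grad h (x k) + (1/2) *\<^sub>R grad h (y k)) (x (Suc k))"
      using assms(17) k unfolding bdrs_def by blast+
    have ik: "{x k, w k, xbar k, z k, y k, x (Suc k)} \<subseteq> interior (edom h)"
      using int[OF k] xint[of "Suc k"] by simp
    have "1 / sqrt (real k) > 0" using k by simp
    from bdrs_step[OF h f g im Cf Cg L xs this ik it]
    show ?thesis using k by (simp add: \<Phi>_def B_def power_divide)
  qed
  \<comment> \<open>The Bregman distance from \<open>xs\<close> to the current iterate serves as the
    Lyapunov function.\<close>
  have "b N \<le> (rbregman h xs (x 1) + B * (1 + ln (real N))) / sqrt (real N)" if N: "N \<ge> 1" for N
    by (rule inverse_sqrt_step_rate[where d = "\<lambda>k. rbregman h xs (x k)" and \<phi> = "\<lambda>k. \<Phi> (x (Suc k)) - \<Phi> xs"])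
      (use b[OF N] B step N rbregman_nonneg[OF h assms(16) xint] in auto)
  from ln_over_sqrt_rate[OF b(2) this]
  have rate: "b \<longlonglongrightarrow> 0" "b \<in> O(\<lambda>N. ln (real N) / sqrt (real N))" by auto
  have "(\<lambda>N. ereal (b N)) \<longlonglongrightarrow> 0" using rate(1) by (simp add: zero_ereal_def)
  \<comment> \<open>At \<open>N = 0\<close> the gap is a minimum over the empty set, so the two
    sequences are identified only from index 1 on.\<close>
  moreover have "eventually (\<lambda>N. ereal (b N) = best_gap f g x xs N) sequentially"
    using b(1) by (auto intro: eventually_mono[OF eventually_ge_at_top[of 1]])
  ultimately have "best_gap f g x xs \<longlonglongrightarrow> 0" by (rule Lim_transform_eventually)
  then show ?thesis using rate(2) unfolding b_def by blast
qed

end
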